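(* Let $d\ge 1$ and let $S=\{a_1,\ldots,a_m\}\subset(0,1)^d$ be a finite point set. For every sufficiently small $\varepsilon>0$ there exists a constant $\alpha>0$, independent of $n$, such that $$\mathbb{P}\bigl(\mathcal{P}_n \text{ contains a scaled } \varepsilon\text{-copy of } S\bigr)\ \ge\ 1-e^{-\alpha n},$$ where $\mathcal{P}_n$ is a Poisson point sample over $[0,1]^d$ with an expected number of $n$ points.
   Context: For $n\in\mathbb{N}$, a Poisson point sample $\mathcal{P}_n$ over $[0,1]^d$ is obtained by sampling $N$ from the Poisson distribution with rate $n$ and then sampling $N$ points independently and uniformly at random from $[0,1]^d$. Scaled copies: let $S=\{a_1,\ldots,a_m\}\subset(0,1)^d$ (distinct points) and let $B_i$ be the ball of radius $\varepsilon$ centered at $a_i$. "$\varepsilon$ sufficiently small" means that $B_1,\ldots,B_m$ are pairwise disjoint and each is contained in the unit cube. For an axis-parallel subcube $Q\subset[0,1]^d$ with side length $\ell$ and center $x$, let $Q'\subset Q$ be the axis-parallel subcube with the same center $x$ and side length $\frac{\ell}{4\sqrt d}$. The canonical axis-preserving bijection $[0,1]^d\to Q'$, $y\mapsto x+\frac{\ell}{4\sqrt d}\bigl(y-(\tfrac12,\ldots,\tfrac12)\bigr)$, maps $B_1,\ldots,B_m$ to pairwise disjoint balls $B_1',\ldots,B_m'$ of radius $\frac{\ell\varepsilon}{4\sqrt d}$. A point set $\mathcal{P}$ contains a scaled $\varepsilon$-copy of $S$ in $Q$ if $\mathcal{P}$ contains exactly one point in $B_i'$ for every $i=1,\ldots,m$,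 and $\mathcal{P}$ contains no further point in $Q$. $\mathcal{P}$ contains a scaled $\varepsilon$-copy of $S$ if there exists such a subcube $Q$ for which $\mathcal{P}$ contains a scaled $\varepsilon$-copy of $S$ in $Q$. *)

theory Defs
  imports "HOL-Probability.Probability"
begin

text \<open>The dimension is \<open>d = CARD('n)\<close>; \<open>0\<close> and \<open>1\<close> in
  \<open>real ^ 'n\<close> are the all-zeros and all-ones vectors, so the unit cube is \<open>cbox 0 1\<close>.\<close>

text \<open>An outcome \<open>(N, X)\<close> is a Poisson number of points together with an independent i.i.d.
  sequence of uniform points of the unit cube, of which the first \<open>N\<close> form the sample.
  Rate \<open>0\<close> is treated separately because \<open>poisson_pmf\<close> is only specified for positive
  rates.\<close>

definition poisson_space :: "nat \<Rightarrow> (nat \<times> (nat \<Rightarrow> real ^ 'n)) measure" where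
  "poisson_space n =
     measure_pmf (if n = 0 then return_pmf 0 else poisson_pmf (real n)) \<Otimes>\<^sub>M
     (\<Pi>\<^sub>M i\<in>UNIV. uniform_measure lborel (cbox 0 1))"

definition poisson_sample :: "nat \<times> (nat \<Rightarrow> real ^ 'n) \<Rightarrow> (real ^ 'n) set" where
  "poisson_sample \<omega> = snd \<omega> ` {..<fst \<omega>}"

text \<open>The meaning of ``\<open>\<epsilon>\<close> sufficiently small''; balls are open.\<close>

definition admissible_radius :: "(real ^ 'n) set \<Rightarrow> real \<Rightarrow> bool" where
  "admissible_radius S \<epsilon> \<longleftrightarrow>
     \<epsilon> > 0 \<and> disjoint_family_on (\<lambda>a. ball a \<epsilon>) S \<and> (\<forall>a\<in>S. ball a \<epsilon> \<subseteq> cbox 0 1)"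

definition subcube :: "real ^ 'n \<Rightarrow> real \<Rightarrow> (real ^ 'n) set" where
  "subcube x l = cbox (x - (l / 2) *\<^sub>R 1) (x + (l / 2) *\<^sub>R 1)"

text \<open>The axis-preserving bijection of the unit cube onto the subcube \<open>Q'\<close> with centre \<open>x\<close> and side
  length \<open>l / (4 sqrt d)\<close>.\<close>

definition to_inner_cube :: "real ^ 'n \<Rightarrow> real \<Rightarrow> real ^ 'n \<Rightarrow> real ^ 'n" where
  "to_inner_cube x l y = x + (l / (4 * sqrt (real CARD('n)))) *\<^sub>R (y - (1 / 2) *\<^sub>R 1)"

definition scaled_copy_in ::
  "(real ^ 'n) set \<Rightarrow> real \<Rightarrow> (real ^ 'n) set \<Rightarrow> real ^ 'n \<Rightarrow> real \<Rightarrow> bool" where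
  "scaled_copy_in S \<epsilon> P x l \<longleftrightarrow>
     (\<forall>a\<in>S. \<exists>!p. p \<in> P \<inter> to_inner_cube x l ` ball a \<epsilon>) \<and>
     P \<inter> subcube x l \<subseteq> (\<Union>a\<in>S. to_inner_cube x l ` ball a \<epsilon>)"

definition contains_scaled_copy ::
  "(real ^ 'n) set \<Rightarrow> real \<Rightarrow> (real ^ 'n) set \<Rightarrow> bool" where
  "contains_scaled_copy S \<epsilon> P \<longleftrightarrow>
     (\<exists>x l. l > 0 \<and> subcube x l \<subseteq> cbox 0 1 \<and> scaled_copy_in S \<epsilon> P x l)"

end

theory Submission
  imports Defs
begin

text \<open>Place \<open>k ^ d\<close> pairwise disjoint subcubes of side \<open>1 / (2 k)\<close> on a grid, with \<open>k ^ d\<close> between \<open>n\<close>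
  and \<open>2 ^ d * n\<close>. Each subcube and each ball in it then has an expected number of points that is bounded
  away from \<open>0\<close> and \<open>\<infinity>\<close>, so a given subcube contains a scaled copy with probability at least some
  \<open>q > 0\<close> not depending on \<open>n\<close>. By independence of the Poisson process on disjoint sets, all of them
  fail with probability at most \<open>(1 - q) ^ (k ^ d) \<le> exp (- q n)\<close>. The independence is obtained from an
  exact formula for the probability that prescribed disjoint sets are hit exactly once and the
  rest of a region is avoided: condition on the number of points and count the injections that
  assign indices to the sets.\<close>

section \<open>Patterns of a Poisson sample\<close>

text \<open>Hits are counted by index, not by position, so a point sampled twice counts twice: this makes the
  probability of the event a product, and the event is contained in the one on sets of points.\<close>

definition pattern :: "'i set \<Rightarrow> ('i \<Rightarrow> 'a set) \<Rightarrow> 'a set \<Rightarrow> nat \<Rightarrow> (nat \<Rightarrow> 'a) \<Rightarrow> bool" where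
  "pattern I B W N X \<longleftrightarrow>
     (\<forall>i\<in>I. \<exists>!k. k < N \<and> X k \<in> B i) \<and> (\<forall>k<N. X k \<in> W \<longrightarrow> X k \<in> (\<Union>i\<in>I. B i))"

text \<open>\<open>\<sigma> i\<close> is the index of the one sample point in \<open>B i\<close>;
  disjointness makes it injective, and every other index must avoid \<open>W\<close>. The right-hand
  side is in this form because for fixed \<open>\<sigma>\<close> it is one separate condition on
  each \<open>X k\<close>, to which independence of the points applies.\<close>

lemma pattern_iff_injection:
  assumes disj: "disjoint_family_on B I" and sub: "(\<Union>i\<in>I. B i) \<subseteq> W"
  shows "pattern I B W N X \<longleftrightarrow>
    (\<exists>\<sigma>\<in>{\<sigma> \<in> I \<rightarrow>\<^sub>E {..<N}. inj_on \<sigma> I}.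
      \<forall>k<N. X k \<in> (if k \<in> \<sigma> ` I then B (inv_into I \<sigma> k) else - W))"
proof
  assume P: "pattern I B W N X"
  define \<sigma> where "\<sigma> = (\<lambda>i\<in>I. THE k. k < N \<and> X k \<in> B i)"
  have \<sigma>: "\<sigma> i < N \<and> X (\<sigma> i) \<in> B i" if "i \<in> I" for i
    using theI'[of "\<lambda>k. k < N \<and> X k \<in> B i"] P that by (simp add: pattern_def \<sigma>_def)
  have \<sigma>_unique: "k = \<sigma> i" if "i \<in> I" "k < N" "X k \<in> B i" for i k
    using P that \<sigma>[OF that(1)] by (auto simp: pattern_def)
  have inj: "inj_on \<sigma> I"
  proof (rule inj_onI)
    fix i j assume "i \<in> I" "j \<in> I" "\<sigma> i = \<sigma> j"
    then show "i = j"
      using \<sigma>[of i] \<sigma>[of j] disj by (auto simp: disjoint_family_on_def)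
  qed
  have "X k \<in> (if k \<in> \<sigma> ` I then B (inv_into I \<sigma> k) else - W)" if "k < N" for k
  proof (cases "k \<in> \<sigma> ` I")
    case True
    then show ?thesis using \<sigma> inj by auto
  next
    case False
    then have "X k \<notin> B i" if "i \<in> I" for i
      using \<sigma>_unique[OF that \<open>k < N\<close>] that by blast
    then show ?thesis using P False that by (auto simp: pattern_def)
  qed
  moreover have "\<sigma> \<in> I \<rightarrow>\<^sub>E {..<N}"
    using \<sigma> by (auto simp: \<sigma>_def)
  ultimately show "\<exists>\<sigma>\<in>{\<sigma> \<in> I \<rightarrow>\<^sub>E {..<N}. inj_on \<sigma> I}.
      \<forall>k<N. X k \<in> (if k \<in> \<sigma> ` I then B (inv_into I \<sigma> k) else - W)"
    using inj by blast
next
  assume "\<exists>\<sigma>\<in>{\<sigma> \<in> I \<rightarrow>\<^sub>E {..<N}. inj_on \<sigma> I}.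
      \<forall>k<N. X k \<in> (if k \<in> \<sigma> ` I then B (inv_into I \<sigma> k) else - W)"
  then obtain \<sigma> where \<sigma>: "\<sigma> \<in> I \<rightarrow>\<^sub>E {..<N}" "inj_on \<sigma> I"
    and X: "\<And>k. k < N \<Longrightarrow> X k \<in> (if k \<in> \<sigma> ` I then B (inv_into I \<sigma> k) else - W)"
    by blast
  have in_B: "\<sigma> i < N \<and> X (\<sigma> i) \<in> B i" if "i \<in> I" for i
    using X[of "\<sigma> i"] \<sigma> that by (auto simp: PiE_iff split: if_splits)
  have "k = \<sigma> i" if k: "i \<in> I" "k < N" "X k \<in> B i" for i k
  proof -
    have "X k \<in> W" using k sub by auto
    then obtain j where "j \<in> I" "k = \<sigma> j"
      using X[OF k(2)] by (auto split: if_splits)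
    then show ?thesis
      using in_B[of j] k disj by (cases "i = j") (auto simp: disjoint_family_on_def)
  qed
  moreover have "X k \<in> (\<Union>i\<in>I. B i)" if "k < N" "X k \<in> W" for k
    using X[OF that(1)] that(2) in_B by (auto split: if_splits)
  ultimately show "pattern I B W N X"
    using in_B unfolding pattern_def by metis
qed

text \<open>The falling factorial is written as a quotient so that \<open>fact N\<close> later
  cancels against the Poisson weight of \<open>N\<close>.\<close>

lemma card_injections:
  assumes "finite I"
  shows "real (card {\<sigma> \<in> I \<rightarrow>\<^sub>E {..<N}. inj_on \<sigma> I}) =
    (if card I \<le> N then fact N / fact (N - card I) else 0)"
proof -
  \<comment> \<open>For \<open>r > N\<close> the product contains the factor with
    \<open>i = N\<close>, which is 0; this is the \<open>else\<close> branch.\<close>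
  have "real (\<Prod>i = 0..<r. N - i) = (if r \<le> N then fact N / fact (N - r) else 0)" for r
  proof (induction r)
    case (Suc r)
    show ?case
    proof (cases "Suc r \<le> N")
      case True
      then have "fact (N - r) = real (N - r) * fact (N - Suc r)"
        by (metis Suc_diff_Suc Suc_le_lessD fact_Suc)
      have "real (\<Prod>i = 0..<Suc r. N - i) = fact N / fact (N - r) * real (N - r)"
        using Suc True by simp
      then show ?thesis
        using True \<open>fact (N - r) = real (N - r) * fact (N - Suc r)\<close> by simp
    next
      case False
      then show ?thesis using Suc by (auto simp: not_le less_Suc_eq_le)
    qed
  qed simp
  then show ?thesis
    using card_inj_on_subset_funcset[OF assms finite_lessThan[of N] order_refl] by simp
qed

lemma measure_PiM_UNIV_Collect:
  assumes "prob_space U" "finite J" "\<And>k. k \<in> J \<Longrightarrow> H k \<in> sets U"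
  shows "measure (\<Pi>\<^sub>M i\<in>UNIV. U) {X \<in> space (\<Pi>\<^sub>M i\<in>UNIV. U). \<forall>k\<in>J. X k \<in> H k}
    = (\<Prod>k\<in>J. measure U (H k))"
proof -
  interpret product_prob_space "\<lambda>_. U" UNIV
    using assms(1) by (simp add: product_prob_space_def product_prob_space_axioms_def product_sigma_finite_def prob_space_imp_sigma_finite)
  show ?thesis
    using emeasure_PiM_Collect[of J H] assms
    by (simp add: M.emeasure_eq_measure P.emeasure_eq_measure prod_ennreal prod_nonneg)
qed

text \<open>The event is a finite disjoint union over the injections \<open>\<sigma>\<close>. Each
  part is a cylinder event in which \<open>card I\<close> coordinates are confined to the sets
  \<open>B i\<close> and the remaining \<open>N - card I\<close> avoid \<open>W\<close>, so all
  parts have the same probability and only their number is left to count.\<close>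

lemma
  fixes B :: "'i \<Rightarrow> 'a set"
  assumes U: "prob_space U" and "finite I"
    and B: "\<And>i. i \<in> I \<Longrightarrow> B i \<in> sets U" and W: "W \<in> sets U"
    and disj: "disjoint_family_on B I" and sub: "(\<Union>i\<in>I. B i) \<subseteq> W"
  shows sets_pattern:
      "{X \<in> space (\<Pi>\<^sub>M i\<in>UNIV. U). pattern I B W N X} \<in> sets (\<Pi>\<^sub>M i\<in>(UNIV :: nat set). U)"
    and measure_pattern:
      "measure (\<Pi>\<^sub>M i\<in>UNIV. U) {X \<in> space (\<Pi>\<^sub>M i\<in>UNIV. U). pattern I B W N X} =
    (if card I \<le> N then fact N / fact (N - card I) else 0) *
      (\<Prod>i\<in>I. measure U (B i)) * (1 - measure U W) ^ (N - card I)"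
proof -
  interpret prob_space U by fact
  interpret product_prob_space "\<lambda>_. U" UNIV by unfold_locales
  let ?M = "\<Pi>\<^sub>M i\<in>(UNIV :: nat set). U"
  let ?F = "{\<sigma> \<in> I \<rightarrow>\<^sub>E {..<N}. inj_on \<sigma> I}"
  \<comment> \<open>The complement of \<open>W\<close> is taken inside \<open>space U\<close> to be
    measurable; for \<open>X\<close> in the product space this imposes the same condition as
    \<open>- W\<close>.\<close>
  define H where "H \<sigma> k = (if k \<in> \<sigma> ` I then B (inv_into I \<sigma> k) else space U - W)" for \<sigma> :: "'i \<Rightarrow> nat" and k
  define D where "D \<sigma> = {X \<in> space ?M. \<forall>k\<in>{..<N}. X k \<in> H \<sigma> k}" for \<sigma>
  have fin: "finite ?F"
    by (rule finite_subset[OF _ finite_PiE[OF \<open>finite I\<close>, of "\<lambda>_. {..<N}"]]) auto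
  have H: "H \<sigma> k \<in> sets U" if "\<sigma> \<in> ?F" for \<sigma> k
    using that B W by (auto simp: H_def)
  have DE: "{X \<in> space ?M. pattern I B W N X} = (\<Union>\<sigma>\<in>?F. D \<sigma>)"
  proof -
    have "(\<forall>k<N. X k \<in> (if k \<in> \<sigma> ` I then B (inv_into I \<sigma> k) else - W)) \<longleftrightarrow>
        (\<forall>k\<in>{..<N}. X k \<in> H \<sigma> k)" if "X \<in> space ?M" for X \<sigma>
      using that by (auto simp: H_def space_PiM PiE_iff)
    then show ?thesis
      unfolding pattern_iff_injection[OF disj sub] D_def by blast
  qed
  have D_sets: "D \<sigma> \<in> sets ?M" if "\<sigma> \<in> ?F" for \<sigma>
    unfolding D_def using H[OF that] by measurable
  show "{X \<in> space ?M. pattern I B W N X} \<in> sets ?M"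
    unfolding DE using fin D_sets by (intro sets.finite_UN) auto
  have D_prob: "measure ?M (D \<sigma>) = (\<Prod>i\<in>I. measure U (B i)) * (1 - measure U W) ^ (N - card I)"
    if \<sigma>: "\<sigma> \<in> ?F" for \<sigma>
  proof -
    have im: "\<sigma> ` I \<subseteq> {..<N}" and card: "card (\<sigma> ` I) = card I"
      using \<sigma> by (auto simp: card_image)
    have "measure ?M (D \<sigma>) = (\<Prod>k<N. measure U (H \<sigma> k))"
      unfolding D_def by (rule measure_PiM_UNIV_Collect[OF U]) (use H[OF \<sigma>] in auto)
    also have "\<dots> = (\<Prod>k\<in>\<sigma> ` I. measure U (H \<sigma> k)) * (\<Prod>k\<in>{..<N} - \<sigma> ` I. measure U (H \<sigma> k))"
      using prod.subset_diff[OF im, of "\<lambda>k. measure U (H \<sigma> k)"] by (simp add: mult.commute)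
    also have "(\<Prod>k\<in>\<sigma> ` I. measure U (H \<sigma> k)) = (\<Prod>i\<in>I. measure U (B i))"
      using \<sigma> by (subst prod.reindex) (auto simp: H_def)
    also have "(\<Prod>k\<in>{..<N} - \<sigma> ` I. measure U (H \<sigma> k)) = (1 - measure U W) ^ (N - card I)"
      using im card \<open>finite I\<close> by (simp add: H_def prob_space.prob_compl[OF U W] card_Diff_subset)
    finally show ?thesis .
  qed
  have D_disj: "disjoint_family_on D ?F"
  proof -
    \<comment> \<open>The point \<open>X (\<sigma> i)\<close> lies in \<open>B i\<close> and hence
      in \<open>W\<close>, so under \<open>\<tau>\<close> its index must be assigned to some
      \<open>B j\<close>; disjointness then gives \<open>i = j\<close>.\<close>
    have "\<sigma> = \<tau>" if \<sigma>: "\<sigma> \<in> ?F" and \<tau>: "\<tau> \<in> ?F" and X: "X \<in> D \<sigma>" "X \<in> D \<tau>" for \<sigma> \<tau> X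
    proof (rule PiE_ext)
      show "\<sigma> \<in> I \<rightarrow>\<^sub>E {..<N}" "\<tau> \<in> I \<rightarrow>\<^sub>E {..<N}" using \<sigma> \<tau> by auto
      fix i assume i: "i \<in> I"
      then have "\<sigma> i < N" and "X (\<sigma> i) \<in> B i"
        using \<sigma> X(1) by (auto simp: D_def H_def dest!: bspec[of _ _ "\<sigma> i"])
      moreover from this have "X (\<sigma> i) \<in> H \<tau> (\<sigma> i)" "X (\<sigma> i) \<in> W"
        using X(2) sub i by (auto simp: D_def)
      ultimately obtain j where j: "j \<in> I" "\<sigma> i = \<tau> j" "X (\<sigma> i) \<in> B j"
        using \<tau> by (auto simp: H_def split: if_splits)
      then have "i = j"
        using disj i \<open>X (\<sigma> i) \<in> B i\<close> by (auto simp: disjoint_family_on_def)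
      then show "\<sigma> i = \<tau> i" using j by simp
    qed
    then show ?thesis unfolding disjoint_family_on_def by blast
  qed
  have "measure ?M {X \<in> space ?M. pattern I B W N X} = (\<Sum>\<sigma>\<in>?F. measure ?M (D \<sigma>))"
    unfolding DE using fin D_sets D_disj by (intro P.finite_measure_finite_Union) auto
  also have "\<dots> = real (card ?F) * ((\<Prod>i\<in>I. measure U (B i)) * (1 - measure U W) ^ (N - card I))"
    by (simp add: D_prob)
  finally show "measure ?M {X \<in> space ?M. pattern I B W N X} =
    (if card I \<le> N then fact N / fact (N - card I) else 0) *
      (\<Prod>i\<in>I. measure U (B i)) * (1 - measure U W) ^ (N - card I)"
    by (simp add: card_injections[OF \<open>finite I\<close>])
qed

text \<open>Averaging over \<open>N\<close> turns the conditional probabilities into an exponential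
  series. The result contains no trace of \<open>N\<close>: it is a product over the sets times an
  exponential in the measure of \<open>W\<close>, and this multiplicative shape is what yields
  independence below.\<close>

lemma measure_poisson_pattern:
  assumes rate: "0 < (c::real)" and U: "prob_space U" and "finite I"
    and B: "\<And>i. i \<in> I \<Longrightarrow> B i \<in> sets U" and W: "W \<in> sets U"
    and disj: "disjoint_family_on B I" and sub: "(\<Union>i\<in>I. B i) \<subseteq> W"
  defines "M \<equiv> measure_pmf (poisson_pmf c) \<Otimes>\<^sub>M (\<Pi>\<^sub>M i\<in>UNIV. U)"
  shows "{\<omega> \<in> space M. pattern I B W (fst \<omega>) (snd \<omega>)} \<in> sets M" (is "?E \<in> _")
    and "measure M {\<omega> \<in> space M. pattern I B W (fst \<omega>) (snd \<omega>)} =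
      (\<Prod>i\<in>I. c * measure U (B i)) * exp (- c * measure U W)"
proof -
  let ?M = "\<Pi>\<^sub>M i\<in>(UNIV :: nat set). U"
  let ?P = "\<lambda>N. {X \<in> space ?M. pattern I B W N X}"
  interpret prob_space U by fact
  interpret P: prob_space ?M by (rule prob_space_PiM) (rule U)
  have E: "?E = (\<Union>N. {N} \<times> ?P N)"
    by (auto simp: M_def space_pair_measure)
  have P: "?P N \<in> sets ?M" for N
    using sets_pattern[OF U \<open>finite I\<close> B W disj sub] .
  show sets: "?E \<in> sets M"
    unfolding E unfolding M_def by (intro sets.countable_UN) (auto intro!: pair_measureI P)
  define b where "b = (\<Prod>i\<in>I. measure U (B i))"
  define w where "w = measure U W"
  let ?r = "card I"
  let ?f = "\<lambda>N. pmf (poisson_pmf c) N * measure ?M (?P N)"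
  \<comment> \<open>Here \<open>k = N - card I\<close> is the number of points outside
    \<open>W\<close>. Once \<open>fact N\<close> cancels, the terms with
    \<open>N \<ge> card I\<close> are a constant multiple of this series.\<close>
  have "(\<lambda>k. (c * (1 - w)) ^ k /\<^sub>R fact k) sums exp (c * (1 - w))"
    by (rule exp_converges)
  then have "(\<lambda>k. (c ^ ?r * b * exp (- c)) * ((c * (1 - w)) ^ k /\<^sub>R fact k))
      sums ((c ^ ?r * b * exp (- c)) * exp (c * (1 - w)))"
    by (rule sums_mult)
  also have "(\<lambda>k. (c ^ ?r * b * exp (- c)) * ((c * (1 - w)) ^ k /\<^sub>R fact k)) = (\<lambda>k. ?f (k + ?r))"
    using rate unfolding power_mult_distrib
    by (simp add: fun_eq_iff measure_pattern[OF U \<open>finite I\<close> B W disj sub] b_def w_def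
        power_add divide_simps)
  also have "(c ^ ?r * b * exp (- c)) * exp (c * (1 - w)) = c ^ ?r * b * exp (- c * w)"
    by (simp add: exp_add[symmetric] algebra_simps)
  finally have "?f sums (c ^ ?r * b * exp (- c * w) + (\<Sum>N<?r. ?f N))"
    by (rule sums_iff_shift[of ?f ?r, THEN iffD1])
  \<comment> \<open>With fewer than \<open>card I\<close> points the disjoint sets cannot all be
    hit.\<close>
  moreover have "(\<Sum>N<?r. ?f N) = 0"
    by (intro sum.neutral) (auto simp: measure_pattern[OF U \<open>finite I\<close> B W disj sub])
  ultimately have sums: "?f sums (c ^ ?r * b * exp (- c * w))" by simp
  have "emeasure M ?E = (\<integral>\<^sup>+ N. emeasure ?M (Pair N -` ?E) \<partial>measure_pmf (poisson_pmf c))"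
    using sets unfolding M_def by (rule P.emeasure_pair_measure_alt)
  also have "\<dots> = (\<integral>\<^sup>+ N. ennreal (measure ?M (?P N)) \<partial>measure_pmf (poisson_pmf c))"
    by (intro nn_integral_cong) (auto simp: E P.emeasure_eq_measure[symmetric] intro!: arg_cong[where f = "emeasure ?M"])
  also have "\<dots> = (\<Sum>N. ennreal (?f N))"
    by (simp add: nn_integral_measure_pmf nn_integral_count_space_nat ennreal_mult[symmetric] del: pmf_poisson)
  also have "\<dots> = ennreal (c ^ ?r * b * exp (- c * w))"
    by (rule suminf_ennreal_eq[OF _ sums]) simp
  finally show "measure M ?E = (\<Prod>i\<in>I. c * measure U (B i)) * exp (- c * measure U W)"
    using rate by (simp add: measure_def b_def w_def prod.distrib prod_nonneg)
qed


section \<open>Independence of patterns in disjoint regions\<close>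

text \<open>Computes the probability that all grid subcubes fail at once.
  \<open>indep_events\<close> gives product formulas for intersections of the events themselves, so
  the complements are brought in by an induction over mixed intersections.\<close>

lemma (in prob_space) prob_compl_UN_indep_events:
  assumes "indep_events A I" "finite I"
  shows "prob (space M - (\<Union>i\<in>I. A i)) = (\<Prod>i\<in>I. 1 - prob (A i))"
proof -
  have A: "A i \<in> events" if "i \<in> I" for i
    using assms that by (auto simp: indep_events_def)
  \<comment> \<open>Intersecting with \<open>space M\<close> makes the formula hold for
    \<open>T = {}\<close> as well, where the bare intersection would be \<open>UNIV\<close>.\<close>
  have inter: "prob (space M \<inter> (\<Inter>i\<in>T. A i)) = (\<Prod>i\<in>T. prob (A i))" if "T \<subseteq> I" for T
  proof (cases "T = {}")
    case False
    then have "space M \<inter> (\<Inter>i\<in>T. A i) = (\<Inter>i\<in>T. A i)"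
      using A[THEN sets.sets_into_space] that by blast
    then show ?thesis
      using assms that False finite_subset[OF that] by (auto simp: indep_events_def)
  qed (simp add: prob_space)
  have "prob (space M \<inter> (\<Inter>i\<in>T. A i) - (\<Union>i\<in>K. A i)) =
      (\<Prod>i\<in>T. prob (A i)) * (\<Prod>i\<in>K. 1 - prob (A i))"
    if "finite K" "T \<subseteq> I" "K \<subseteq> I" "T \<inter> K = {}" for T K
    using that
    \<comment> \<open>moving one event at a time from \<open>T\<close> to the complemented side \<open>K\<close>\<close>
  proof (induction K arbitrary: T rule: finite_induct)
    case empty
    then show ?case by (simp add: inter)
  next
    case (insert j K)
    have fin: "finite T" using insert.prems assms finite_subset by blast
    let ?R = "\<lambda>T. space M \<inter> (\<Inter>i\<in>T. A i) - (\<Union>i\<in>K. A i)"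
    have meas: "?R T \<in> events" if "T \<subseteq> I" for T
    proof -
      have "space M \<inter> (\<Inter>i\<in>T. A i) \<in> events"
        using A that finite_subset[OF that assms(2)]
        by (cases "T = {}") (auto intro!: sets.Int sets.finite_INT)
      moreover have "(\<Union>i\<in>K. A i) \<in> events"
        using A insert by (intro sets.finite_UN) auto
      ultimately show ?thesis by blast
    qed
    have "space M \<inter> (\<Inter>i\<in>T. A i) - (\<Union>i\<in>insert j K. A i) = ?R T - ?R (insert j T)"
      by blast
    moreover have "prob (?R T - ?R (insert j T)) = prob (?R T) - prob (?R (insert j T))"
      using insert.prems by (intro finite_measure_Diff meas) auto
    moreover have "prob (?R T) = (\<Prod>i\<in>T. prob (A i)) * (\<Prod>i\<in>K. 1 - prob (A i))"
      using insert.prems by (intro insert.IH) auto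
    moreover have "prob (?R (insert j T)) =
        (\<Prod>i\<in>insert j T. prob (A i)) * (\<Prod>i\<in>K. 1 - prob (A i))"
      using insert.prems insert.hyps by (intro insert.IH) auto
    ultimately show ?case
      using insert.hyps insert.prems fin by (simp add: algebra_simps)
  qed
  from this[of I "{}"] show ?thesis
    using assms by simp
qed

text \<open>Patterns in several disjoint regions together form a single pattern, indexed by pairs
  and confined to the union of the regions. Its exact probability splits into one factor per region,
  since measures of disjoint regions add in the exponent.\<close>

lemma indep_events_poisson_pattern:
  assumes rate: "0 < (c::real)" and U: "prob_space U" and S: "finite S"
    and B: "\<And>v a. v \<in> J \<Longrightarrow> a \<in> S \<Longrightarrow> B v a \<in> sets U" and Q: "\<And>v. v \<in> J \<Longrightarrow> Q v \<in> sets U"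
    and disj_B: "\<And>v. v \<in> J \<Longrightarrow> disjoint_family_on (B v) S" and disj_Q: "disjoint_family_on Q J"
    and sub: "\<And>v. v \<in> J \<Longrightarrow> (\<Union>a\<in>S. B v a) \<subseteq> Q v"
  defines "M \<equiv> measure_pmf (poisson_pmf c) \<Otimes>\<^sub>M (\<Pi>\<^sub>M i\<in>UNIV. U)"
  shows "prob_space.indep_events M
    (\<lambda>v. {\<omega> \<in> space M. pattern S (B v) (Q v) (fst \<omega>) (snd \<omega>)}) J"
proof -
  interpret U: prob_space U by fact
  interpret P: prob_space "\<Pi>\<^sub>M i\<in>(UNIV :: nat set). U" by (rule prob_space_PiM) (rule U)
  interpret PP: pair_prob_space "measure_pmf (poisson_pmf c)" "\<Pi>\<^sub>M i\<in>(UNIV :: nat set). U" ..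
  interpret prob_space M unfolding M_def by unfold_locales
  let ?E = "\<lambda>v. {\<omega> \<in> space M. pattern S (B v) (Q v) (fst \<omega>) (snd \<omega>)}"
  note single = measure_poisson_pattern[OF rate U S B Q disj_B sub, folded M_def]
  have "prob (\<Inter>v\<in>T. ?E v) = (\<Prod>v\<in>T. prob (?E v))"
    if T: "T \<subseteq> J" "T \<noteq> {}" "finite T" for T
  proof -
    let ?B = "\<lambda>(v, a). B v a" and ?W = "\<Union>v\<in>T. Q v"
    have v_unique: "u = v" if "u \<in> T" "v \<in> T" "y \<in> Q u" "y \<in> Q v" for u v y
      using disj_Q that T(1) unfolding disjoint_family_on_def by blast
    have in_Q: "y \<in> Q v" if "v \<in> T" "a \<in> S" "y \<in> B v a" for v a y
      using sub[of v] that T(1) by blast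
    have "(\<forall>v\<in>T. pattern S (B v) (Q v) N X) \<longleftrightarrow> pattern (T \<times> S) ?B ?W N X" for N X
    proof
      assume "\<forall>v\<in>T. pattern S (B v) (Q v) N X"
      then show "pattern (T \<times> S) ?B ?W N X"
        unfolding pattern_def by fastforce
    next
      assume *: "pattern (T \<times> S) ?B ?W N X"
      \<comment> \<open>The joint pattern only places the point in some \<open>B u a\<close>;
        disjointness of the regions identifies \<open>u\<close> with \<open>v\<close>.\<close>
      have "X k \<in> (\<Union>a\<in>S. B v a)" if k: "k < N" "v \<in> T" "X k \<in> Q v" for v k
      proof -
        have "X k \<in> ?W" using k by blast
        then obtain u a where ua: "u \<in> T" "a \<in> S" "X k \<in> B u a"
          using * k unfolding pattern_def by auto
        then have "u = v" using v_unique in_Q k by blast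
        then show ?thesis using ua by blast
      qed
      moreover have "\<exists>!k. k < N \<and> X k \<in> B v a" if "v \<in> T" "a \<in> S" for v a
        using * that unfolding pattern_def by fastforce
      ultimately show "\<forall>v\<in>T. pattern S (B v) (Q v) N X"
        unfolding pattern_def by blast
    qed
    then have E: "(\<Inter>v\<in>T. ?E v) = {\<omega> \<in> space M. pattern (T \<times> S) ?B ?W (fst \<omega>) (snd \<omega>)}"
      using T(2) by blast
    have disj: "disjoint_family_on ?B (T \<times> S)"
      unfolding disjoint_family_on_def
    proof (clarsimp, goal_cases)
      case (1 u a v b)
      show ?case
      proof (rule ccontr)
        assume "B u a \<inter> B v b \<noteq> {}"
        then obtain y where y: "y \<in> B u a" "y \<in> B v b" by blast
        then have "u = v" using v_unique in_Q 1 by blast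
        then show False
          using disj_B[of v] 1 y T(1) unfolding disjoint_family_on_def by blast
      qed
    qed
    have "prob (\<Inter>v\<in>T. ?E v) =
        (\<Prod>i\<in>T \<times> S. c * measure U (?B i)) * exp (- c * measure U ?W)"
      unfolding E unfolding M_def
    proof (rule measure_poisson_pattern(2)[OF rate U _ _ _ disj])
      show "?W \<in> sets U" using Q T by (intro sets.finite_UN) auto
    qed (use T S B in_Q in auto)
    also have "(\<Prod>i\<in>T \<times> S. c * measure U (?B i)) = (\<Prod>v\<in>T. \<Prod>a\<in>S. c * measure U (B v a))"
      by (simp add: prod.cartesian_product case_prod_beta)
    also have "measure U ?W = (\<Sum>v\<in>T. measure U (Q v))"
      using T Q disj_Q
      by (intro U.finite_measure_finite_Union) (auto intro: disjoint_family_on_mono)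
    also have "exp (- c * \<dots>) = (\<Prod>v\<in>T. exp (- c * measure U (Q v)))"
      using T(3) by (simp add: sum_distrib_left exp_sum)
    finally show ?thesis
      using T(1) by (simp add: single(2) prod.distrib[symmetric] subset_iff)
  qed
  moreover have "?E v \<in> events" if "v \<in> J" for v
    using single(1) that by blast
  ultimately show ?thesis
    unfolding indep_events_def by blast
qed

section \<open>Geometry of scaled copies\<close>

text \<open>The map is onto and multiplies all distances by \<open>c\<close>. Knowing the image as a
  ball gives its openness and its volume.\<close>

lemma to_inner_cube_image_ball:
  fixes x a :: "real ^ 'n"
  assumes "0 < l"
  defines "c \<equiv> l / (4 * sqrt (real CARD('n)))"
  shows "to_inner_cube x l ` ball a \<epsilon> = ball (to_inner_cube x l a) (c * \<epsilon>)"
proof -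
  have c: "c > 0" using assms by simp
  have dist: "dist (to_inner_cube x l y) (to_inner_cube x l z) = c * dist y z" for y z :: "real ^ 'n"
    using c by (simp add: to_inner_cube_def c_def[symmetric] dist_norm flip: scaleR_diff_right)
  show ?thesis
  proof (intro set_eqI iffI)
    fix z assume z: "z \<in> ball (to_inner_cube x l a) (c * \<epsilon>)"
    define y where "y = (1 / c) *\<^sub>R (z - x) + (1 / 2) *\<^sub>R 1"
    have y: "z = to_inner_cube x l y"
      using c by (simp add: to_inner_cube_def c_def[symmetric] y_def)
    then have "y \<in> ball a \<epsilon>" using z c by (simp add: dist)
    then show "z \<in> to_inner_cube x l ` ball a \<epsilon>" unfolding y by (rule imageI)
  qed (use c in \<open>auto simp: dist\<close>)
qed

lemma inj_to_inner_cube: "0 < l \<Longrightarrow> inj (to_inner_cube x l :: real ^ 'n \<Rightarrow> _)"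
  by (auto simp: inj_def to_inner_cube_def)

text \<open>The contraction ratio is at most \<open>l\<close>, and coordinates in the unit cube
  differ from 1/2 by at most 1/2, so their images differ from the centre by at most
  \<open>l / 2\<close>.\<close>

lemma to_inner_cube_in_subcube:
  fixes x y :: "real ^ 'n"
  assumes "0 < l" "y \<in> cbox 0 1"
  shows "to_inner_cube x l y \<in> subcube x l"
proof -
  define c where "c = l / (4 * sqrt (real CARD('n)))"
  have "1 \<le> sqrt (real CARD('n))" by simp
  then have "1 \<le> 4 * sqrt (real CARD('n))" by linarith
  then have c: "0 < c" "c \<le> l"
    using assms(1) by (auto simp: c_def divide_le_eq)
  have "\<bar>c * (y $ i - 1 / 2)\<bar> \<le> l / 2" for i
  proof -
    have "0 \<le> y $ i" "y $ i \<le> 1"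
      using assms(2) by (simp_all add: mem_box_cart)
    then have "\<bar>y $ i - 1 / 2\<bar> \<le> 1 / 2" by linarith
    then have "c * \<bar>y $ i - 1 / 2\<bar> \<le> l * (1 / 2)"
      using c by (intro mult_mono) auto
    then show ?thesis using c by (simp add: abs_mult)
  qed
  then have "- (l / 2) \<le> c * (y $ i - 1 / 2) \<and> c * (y $ i - 1 / 2) \<le> l / 2" for i
    by (metis abs_le_iff minus_le_iff)
  then have "x $ i - l / 2 \<le> x $ i + c * (y $ i - 1 / 2) \<and>
      x $ i + c * (y $ i - 1 / 2) \<le> x $ i + l / 2" for i
    by (smt (verit))
  then show ?thesis
    by (simp add: subcube_def mem_box_cart to_inner_cube_def c_def)
qed

section \<open>Volumes and the uniform distribution on the unit cube\<close>

lemma measure_subcube: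
  assumes "0 < l"
  shows "measure lborel (subcube (x :: real ^ 'n) l) = l ^ CARD('n)"
proof -
  have "x \<in> subcube x l"
    using assms by (simp add: subcube_def mem_box_cart)
  then show ?thesis
    unfolding subcube_def by (subst content_cbox_cart) auto
qed

lemma measure_uniform_unit_cube:
  assumes "A \<in> sets borel" "A \<subseteq> cbox 0 1"
  shows "measure (uniform_measure lborel (cbox 0 1)) A = measure lborel (A :: (real ^ 'n) set)"
proof -
  have 0: "(0 :: real ^ 'n) \<in> cbox 0 1" by (simp add: mem_box_cart)
  have m: "measure lborel (cbox 0 (1 :: real ^ 'n)) = 1"
    by (subst content_cbox_cart) (use 0 in auto)
  then have "emeasure lborel (cbox 0 (1 :: real ^ 'n)) = 1"
    using emeasure_lborel_cbox_finite[of "0 :: real ^ 'n" 1] by (simp add: emeasure_eq_ennreal_measure)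
  then show ?thesis
    using assms m by (subst measure_uniform_measure) (auto simp: Int_absorb1)
qed

lemma prob_space_uniform_unit_cube:
  "prob_space (uniform_measure lborel (cbox 0 (1 :: real ^ 'n)))"
proof (rule prob_space_uniform_measure)
  have "(0 :: real ^ 'n) \<in> cbox 0 1" by (simp add: mem_box_cart)
  then have "measure lborel (cbox 0 (1 :: real ^ 'n)) = 1"
    by (subst content_cbox_cart) auto
  then show "emeasure lborel (cbox 0 (1 :: real ^ 'n)) \<noteq> 0"
    by (auto simp: measure_def)
  show "emeasure lborel (cbox 0 (1 :: real ^ 'n)) \<noteq> \<infinity>"
    using emeasure_lborel_cbox_finite[of "0 :: real ^ 'n" 1] by simp
qed

section \<open>From indexed patterns to scaled copies\<close>

lemma pattern_imp_range_pattern: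
  assumes "pattern S B Q N X"
  shows "\<forall>a\<in>S. \<exists>!p. p \<in> X ` {..<N} \<inter> B a"
    and "X ` {..<N} \<inter> Q \<subseteq> (\<Union>a\<in>S. B a)"
proof -
  show "\<forall>a\<in>S. \<exists>!p. p \<in> X ` {..<N} \<inter> B a"
  proof
    fix a assume "a \<in> S"
    then have "\<exists>!k. k < N \<and> X k \<in> B a"
      using assms by (simp add: pattern_def)
    then obtain k where k: "k < N" "X k \<in> B a" "\<And>j. j < N \<Longrightarrow> X j \<in> B a \<Longrightarrow> j = k"
      by blast
    show "\<exists>!p. p \<in> X ` {..<N} \<inter> B a"
    proof (rule ex1I)
      show "X k \<in> X ` {..<N} \<inter> B a" using k(1,2) by simp
      fix p assume "p \<in> X ` {..<N} \<inter> B a"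
      then obtain j where "j < N" "p = X j" "X j \<in> B a" by auto
      then show "p = X k" using k(3)[of j] by blast
    qed
  qed
  show "X ` {..<N} \<inter> Q \<subseteq> (\<Union>a\<in>S. B a)"
    using assms[unfolded pattern_def, THEN conjunct2] by auto
qed

lemma pattern_imp_scaled_copy_in:
  assumes "pattern S (\<lambda>a. to_inner_cube x l ` ball a \<epsilon>) (subcube x l) N X"
  shows "scaled_copy_in S \<epsilon> (X ` {..<N}) x l"
  using pattern_imp_range_pattern[OF assms] unfolding scaled_copy_in_def by (rule conjI)

section \<open>Measurability\<close>

text \<open>The event is an uncountable union over the subcubes. Splitting it according to the label of each
  point (the ball containing it, or none if it lies outside the subcube) leaves a finite union of
  sets that are the intersection of an open set (balls and complements of subcubes are open, and so
  is the union over the subcubes) with a closed one (points with equal labels coincide).\<close>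

definition labelled_region ::
    "real \<Rightarrow> real ^ 'n \<Rightarrow> real \<Rightarrow> (real ^ 'n) option \<Rightarrow> (real ^ 'n) set" where
  "labelled_region \<epsilon> x l b =
    (case b of None \<Rightarrow> - subcube x l | Some a \<Rightarrow> to_inner_cube x l ` ball a \<epsilon>)"

lemma open_labelled_region: "0 < l \<Longrightarrow> open (labelled_region \<epsilon> x l b)"
  by (auto simp: labelled_region_def to_inner_cube_image_ball subcube_def split: option.split)

text \<open>A point determines its label: injectivity keeps the images of the disjoint balls
  disjoint, and all of them lie inside the subcube, away from the region of
  \<open>None\<close>.\<close>

lemma disjoint_labelled_region:
  assumes "admissible_radius S \<epsilon>" "0 < l" "b \<in> insert None (Some ` S)" "b' \<in> insert None (Some ` S)"
    and "y \<in> labelled_region \<epsilon> x l b" "y \<in> labelled_region \<epsilon> x l b'"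
  shows "b = b'"
proof -
  have Q: "to_inner_cube x l ` ball a \<epsilon> \<subseteq> subcube x l" if "a \<in> S" for a
    using assms(1,2) that to_inner_cube_in_subcube unfolding admissible_radius_def by blast
  have D: "a = a'" if "a \<in> S" "a' \<in> S" "y \<in> to_inner_cube x l ` ball a \<epsilon>" "y \<in> to_inner_cube x l ` ball a' \<epsilon>" for a a'
  proof (rule ccontr)
    assume "a \<noteq> a'"
    then have "ball a \<epsilon> \<inter> ball a' \<epsilon> = {}"
      using assms(1) that unfolding admissible_radius_def disjoint_family_on_def by blast
    then show False
      using that(3,4) inj_to_inner_cube[OF assms(2), of x] unfolding inj_def by blast
  qed
  show ?thesis
    using assms(3-6) Q D unfolding labelled_region_def
    by (cases b; cases b') (simp; blast)+
qed

text \<open>That every label \<open>Some a\<close> is used says that each ball is hit; that equal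
  labels force equal points says that it is hit in one position. Coinciding points with different
  indices are thus allowed, as in \<open>scaled_copy_in\<close>.\<close>

lemma scaled_copy_in_iff_labelling:
  assumes adm: "admissible_radius S \<epsilon>" and l: "0 < l"
  shows "scaled_copy_in S \<epsilon> (X ` {..<N}) x l \<longleftrightarrow>
    (\<exists>f \<in> {f \<in> {..<N} \<rightarrow>\<^sub>E insert None (Some ` S). \<forall>a\<in>S. \<exists>k<N. f k = Some a}.
      (\<forall>k<N. X k \<in> labelled_region \<epsilon> x l (f k)) \<and>
      (\<forall>j<N. \<forall>k<N. f j = f k \<and> f k \<noteq> None \<longrightarrow> X j = X k))" (is "?L \<longleftrightarrow> ?R")
proof
  let ?B = "\<lambda>a. to_inner_cube x l ` ball a \<epsilon>"
  note unique = disjoint_labelled_region[OF adm l]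
  have Q: "?B a \<subseteq> subcube x l" if "a \<in> S" for a
    using adm l that to_inner_cube_in_subcube unfolding admissible_radius_def by blast
  {
    assume L: ?L
    have "\<exists>b\<in>insert None (Some ` S). X k \<in> labelled_region \<epsilon> x l b" if "k < N" for k
      using L that unfolding scaled_copy_in_def
      by (cases "X k \<in> subcube x l") (simp_all add: labelled_region_def, blast)
    then obtain g where g: "\<And>k. k < N \<Longrightarrow> g k \<in> insert None (Some ` S) \<and> X k \<in> labelled_region \<epsilon> x l (g k)"
      by metis
    let ?f = "restrict g {..<N}"
    \<comment> \<open>The choice of \<open>g\<close> is in fact forced, because the labelled regions
      are disjoint.\<close>
    have g_eq: "g k = Some a" if "k < N" "a \<in> S" "X k \<in> ?B a" for k a
      using unique[of "g k" "Some a" "X k" x] g[OF that(1)] that(2,3)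
      by (auto simp: labelled_region_def)
    have "\<exists>k<N. ?f k = Some a" if a: "a \<in> S" for a
    proof -
      obtain k where "k < N" "X k \<in> ?B a"
        using L a unfolding scaled_copy_in_def by blast
      then show ?thesis using g_eq a by auto
    qed
    moreover have "X j = X k" if jk: "j < N" "k < N" "?f j = ?f k \<and> ?f k \<noteq> None" for j k
    proof -
      obtain a where a: "g k = Some a" "g j = Some a" "a \<in> S"
        using jk g[of k] by auto
      then have "X j \<in> ?B a" "X k \<in> ?B a"
        using g[of j] g[of k] jk by (auto simp: labelled_region_def)
      then show ?thesis
        using L a jk unfolding scaled_copy_in_def by blast
    qed
    moreover have "?f \<in> {..<N} \<rightarrow>\<^sub>E insert None (Some ` S)"
      using g by auto
    moreover have "\<forall>k<N. X k \<in> labelled_region \<epsilon> x l (?f k)"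
      using g by auto
    ultimately show ?R by blast
  }
  assume ?R
  then obtain f where f: "f \<in> {..<N} \<rightarrow>\<^sub>E insert None (Some ` S)" "\<forall>a\<in>S. \<exists>k<N. f k = Some a"
    and fX: "\<forall>k<N. X k \<in> labelled_region \<epsilon> x l (f k)"
    and feq: "\<forall>j<N. \<forall>k<N. f j = f k \<and> f k \<noteq> None \<longrightarrow> X j = X k"
    by (elim bexE CollectE conjE) (rule that)
  note X = fX[rule_format] and eq = feq[rule_format]
  have f_eq: "f k = Some a" if "k < N" "a \<in> S" "X k \<in> ?B a" for k a
    using unique[of "f k" "Some a" "X k" x] X[OF that(1)] f(1) that
    by (auto simp: labelled_region_def PiE_iff)
  have "\<exists>!p. p \<in> X ` {..<N} \<inter> ?B a" if a: "a \<in> S" for a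
  proof -
    obtain k where k: "k < N" "f k = Some a" using f(2) a by blast
    show ?thesis
    proof (rule ex1I)
      show "X k \<in> X ` {..<N} \<inter> ?B a"
        using X[OF k(1)] k by (simp add: labelled_region_def)
      fix p assume "p \<in> X ` {..<N} \<inter> ?B a"
      then obtain j where j: "j < N" "p = X j" "X j \<in> ?B a" by blast
      then show "p = X k" using f_eq[OF j(1) a j(3)] eq[OF j(1) k(1)] k(2) by simp
    qed
  qed
  moreover have "X ` {..<N} \<inter> subcube x l \<subseteq> (\<Union>a\<in>S. ?B a)"
  proof
    fix p assume "p \<in> X ` {..<N} \<inter> subcube x l"
    then obtain k where k: "k < N" "p = X k" "X k \<in> subcube x l" by blast
    have "f k \<in> insert None (Some ` S)" using f(1) k(1) by (auto simp: PiE_iff)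
    then show "p \<in> (\<Union>a\<in>S. ?B a)"
    proof
      assume "f k = None"
      then show ?thesis using X[OF k(1)] k(3) by (simp add: labelled_region_def)
    next
      assume "f k \<in> Some ` S"
      then obtain a where "a \<in> S" "f k = Some a" by blast
      then show ?thesis using X[OF k(1)] k(2) unfolding labelled_region_def by (intro UN_I) simp_all
    qed
  qed
  ultimately show ?L unfolding scaled_copy_in_def by blast
qed

lemma sets_contains_scaled_copy:
  fixes S :: "(real ^ 'n) set"
  assumes fin: "finite S" and adm: "admissible_radius S \<epsilon>"
  shows "{X. contains_scaled_copy S \<epsilon> (X ` {..<N})} \<in> sets (borel :: (nat \<Rightarrow> real ^ 'n) measure)"
proof -
  define F where "F = {f \<in> {..<N} \<rightarrow>\<^sub>E insert None (Some ` S). \<forall>a\<in>S. \<exists>k<N. f k = Some a}"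
  define O' where "O' f = (\<Union>(x, l) \<in> {(x, l). 0 < l \<and> subcube x l \<subseteq> cbox 0 1}.
      \<Inter>k\<in>{..<N}. {X :: nat \<Rightarrow> real ^ 'n. X k \<in> labelled_region \<epsilon> x l (f k)})" for f
  \<comment> \<open>\<open>C f\<close> does not mention the subcube, so it can be pulled out of the
    uncountable union in \<open>O' f\<close>.\<close>
  define C where "C f = (\<Inter>j\<in>{..<N}. \<Inter>k\<in>{..<N}.
      {X :: nat \<Rightarrow> real ^ 'n. f j = f k \<and> f k \<noteq> None \<longrightarrow> X j = X k})"
    for f :: "nat \<Rightarrow> (real ^ 'n) option"
  have "finite F"
    unfolding F_def
    by (rule finite_subset[OF _ finite_PiE[of "{..<N}" "\<lambda>_. insert None (Some ` S)"]]) (use fin in auto)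
  \<comment> \<open>Coordinate projections are continuous in the product topology on
    sequences.\<close>
  have "open {X :: nat \<Rightarrow> real ^ 'n. X k \<in> labelled_region \<epsilon> x l b}" if "0 < l" for k x l b
    using open_vimage[OF open_labelled_region[OF that], of "\<lambda>X. X k"]
    by (simp add: vimage_def)
  then have "open (O' f)" for f
    unfolding O'_def by (intro open_UN ballI) (auto intro!: open_INT)
  moreover have "closed (C f)" for f
    unfolding C_def
    by (intro closed_INT ballI closed_Collect_imp closed_Collect_eq open_Collect_const) auto
  ultimately have "O' f \<inter> C f \<in> sets borel" for f by auto
  then have "(\<Union>f\<in>F. O' f \<inter> C f) \<in> sets borel"
    using \<open>finite F\<close> by (intro sets.finite_UN) auto
  also have "(\<Union>f\<in>F. O' f \<inter> C f) = {X. contains_scaled_copy S \<epsilon> (X ` {..<N})}"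
  proof (intro set_eqI)
    fix X :: "nat \<Rightarrow> real ^ 'n"
    have O': "X \<in> O' f \<longleftrightarrow> (\<exists>x l. 0 < l \<and> subcube x l \<subseteq> cbox 0 1 \<and>
        (\<forall>k<N. X k \<in> labelled_region \<epsilon> x l (f k)))" for f
      by (auto simp: O'_def)
    have C: "X \<in> C f \<longleftrightarrow> (\<forall>j<N. \<forall>k<N. f j = f k \<and> f k \<noteq> None \<longrightarrow> X j = X k)" for f
      unfolding C_def by blast
    have "X \<in> {X. contains_scaled_copy S \<epsilon> (X ` {..<N})} \<longleftrightarrow>
        (\<exists>x l. 0 < l \<and> subcube x l \<subseteq> cbox 0 1 \<and>
          (\<exists>f\<in>F. (\<forall>k<N. X k \<in> labelled_region \<epsilon> x l (f k)) \<and> X \<in> C f))"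
      unfolding contains_scaled_copy_def F_def C mem_Collect_eq
      by (simp add: scaled_copy_in_iff_labelling[OF adm] cong: conj_cong)
    also have "\<dots> \<longleftrightarrow> (\<exists>f\<in>F. X \<in> O' f \<and> X \<in> C f)"
      unfolding O' by blast
    finally show "X \<in> (\<Union>f\<in>F. O' f \<inter> C f) \<longleftrightarrow> X \<in> {X. contains_scaled_copy S \<epsilon> (X ` {..<N})}"
      by simp
  qed
  finally show ?thesis .
qed

text \<open>The product sigma-algebra on sequences is the Borel sigma-algebra of the product
  topology, so each slice with fixed \<open>N\<close> is measurable, and there are countably many
  slices.\<close>

lemma sets_poisson_space_contains_scaled_copy:
  fixes S :: "(real ^ 'n) set"
  assumes "finite S" "admissible_radius S \<epsilon>"
  shows "{\<omega> \<in> space (poisson_space n). contains_scaled_copy S \<epsilon> (poisson_sample \<omega>)}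
    \<in> sets (poisson_space n)"
proof -
  let ?M = "\<Pi>\<^sub>M i\<in>(UNIV :: nat set). uniform_measure lborel (cbox 0 (1 :: real ^ 'n))"
  have "sets ?M = sets (\<Pi>\<^sub>M i\<in>(UNIV :: nat set). (borel :: (real ^ 'n) measure))"
    by (intro sets_PiM_cong) auto
  then have "sets ?M = sets borel"
    by (simp add: sets_PiM_equal_borel)
  then have *: "{X. contains_scaled_copy S \<epsilon> (X ` {..<N})} \<in> sets ?M" for N
    using sets_contains_scaled_copy[OF assms] by simp
  have "{\<omega> \<in> space (poisson_space n). contains_scaled_copy S \<epsilon> (poisson_sample \<omega>)} =
      (\<Union>N. {N} \<times> {X. contains_scaled_copy S \<epsilon> (X ` {..<N})})"
    by (auto simp: poisson_space_def poisson_sample_def space_pair_measure space_PiM)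
  also have "\<dots> \<in> sets (poisson_space n)"
    unfolding poisson_space_def
    by (intro sets.countable_UN) (auto intro!: pair_measureI *)
  finally show ?thesis .
qed

section \<open>The grid of subcubes\<close>

text \<open>For the least \<open>k\<close> with \<open>n \<le> k ^ d\<close>, minimality gives
  \<open>(k - 1) ^ d < n\<close>, and \<open>k \<le> 2 * (k - 1)\<close> once
  \<open>k \<ge> 2\<close>; this costs the factor \<open>2 ^ d\<close>.\<close>

lemma exists_grid_size:
  fixes n d :: nat
  assumes "1 \<le> n" "1 \<le> d"
  obtains k where "1 \<le> k" "n \<le> k ^ d" "k ^ d \<le> 2 ^ d * n"
proof -
  define k where "k = (LEAST k. n \<le> k ^ d)"
  have "n \<le> n ^ d" using assms by (simp add: self_le_power)
  then have k: "n \<le> k ^ d" unfolding k_def by (rule LeastI)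
  then have "1 \<le> k" using assms by (cases k) (auto simp: zero_power)
  moreover have "k ^ d \<le> 2 ^ d * n"
  proof (cases "k = 1")
    case False
    have "(k - 1) ^ d < n"
      using not_less_Least[of "k - 1" "\<lambda>k. n \<le> k ^ d"] \<open>1 \<le> k\<close> unfolding k_def[symmetric] by simp
    moreover have "k ^ d \<le> (2 * (k - 1)) ^ d"
      using False \<open>1 \<le> k\<close> by (intro power_mono) auto
    ultimately show ?thesis
      by (simp add: power_mult_distrib) (meson le_trans less_imp_le mult_le_mono2)
  qed (use assms in \<open>simp add: Suc_le_eq\<close>)
  ultimately show ?thesis using k that by blast
qed

text \<open>The centre of cell \<open>v\<close> when the unit cube is cut into cells of side
  \<open>1 / k\<close>. Subcubes of half that side leave gaps, so even the closed subcubes are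
  disjoint.\<close>

definition grid_center :: "nat \<Rightarrow> ('n \<Rightarrow> nat) \<Rightarrow> real ^ 'n" where
  "grid_center k v = (\<chi> i. (real (v i) + 1 / 2) / real k)"

text \<open>Rescaling by \<open>k\<close> reduces containment and disjointness to comparing integers
  shifted by quarters.\<close>

lemma mem_grid_subcube:
  assumes "0 < k"
  shows "y \<in> subcube (grid_center k v) (1 / (2 * real k)) \<longleftrightarrow>
    (\<forall>i. real (v i) + 1 / 4 \<le> real k * y $ i \<and> real k * y $ i \<le> real (v i) + 3 / 4)"
proof -
  have "grid_center k v $ i - 1 / (2 * real k) / 2 = (real (v i) + 1 / 4) / real k"
    "grid_center k v $ i + 1 / (2 * real k) / 2 = (real (v i) + 3 / 4) / real k" for i
    using assms by (simp_all add: grid_center_def field_simps)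
  then show ?thesis
    using assms by (simp add: subcube_def mem_box_cart divide_le_eq le_divide_eq mult.commute)
qed

lemma grid_subcube_in_unit_cube:
  assumes "v \<in> UNIV \<rightarrow>\<^sub>E {..<k}" "0 < k"
  shows "subcube (grid_center k v) (1 / (2 * real k)) \<subseteq> cbox 0 1"
proof
  fix y assume "y \<in> subcube (grid_center k v) (1 / (2 * real k))"
  then have y: "real (v i) + 1 / 4 \<le> real k * y $ i" "real k * y $ i \<le> real (v i) + 3 / 4" for i
    using mem_grid_subcube[OF assms(2)] by auto
  have "0 \<le> y $ i \<and> y $ i \<le> 1" for i
  proof -
    have "Suc (v i) \<le> k" using assms(1) by (auto simp: PiE_iff Suc_le_eq)
    then have "real (Suc (v i)) \<le> real k" by (simp only: of_nat_le_iff)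
    then have "real k * 0 \<le> real k * y $ i" "real k * y $ i \<le> real k * 1"
      using y[of i] unfolding of_nat_Suc mult_zero_right mult_1_right by linarith+
    then show ?thesis
      using assms(2) by (simp only: mult_le_cancel_left_pos of_nat_0_less_iff)
  qed
  then show "y \<in> cbox 0 1" by (simp add: mem_box_cart)
qed

lemma disjoint_grid_subcubes:
  assumes "0 < k"
  shows "disjoint_family_on (\<lambda>v. subcube (grid_center k v) (1 / (2 * real k))) J"
  unfolding disjoint_family_on_def
proof (intro ballI impI equals0I)
  fix u v y
  assume "u \<noteq> v"
    and "y \<in> subcube (grid_center k u) (1 / (2 * real k)) \<inter> subcube (grid_center k v) (1 / (2 * real k))"
  then have y: "\<forall>i. real (u i) + 1 / 4 \<le> real k * y $ i \<and> real k * y $ i \<le> real (u i) + 3 / 4"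
    "\<forall>i. real (v i) + 1 / 4 \<le> real k * y $ i \<and> real k * y $ i \<le> real (v i) + 3 / 4"
    by (simp_all add: mem_grid_subcube[OF assms])
  have "u i = v i" for i
  proof -
    \<comment> \<open>Both integers are within 3/4 below the same number and at least 1/4 below it,
      so they differ by at most 1/2.\<close>
    have "real (u i) < real (Suc (v i))" "real (v i) < real (Suc (u i))"
      using y[rule_format, of i] unfolding of_nat_Suc by linarith+
    then show ?thesis by simp
  qed
  then show False using \<open>u \<noteq> v\<close> by auto
qed

section \<open>The probability that every grid subcube fails\<close>

theorem theorem2p1:
  fixes S :: "(real ^ 'n) set" and \<epsilon> :: real
  assumes "finite S" and "S \<subseteq> box 0 1"
    and "admissible_radius S \<epsilon>"
  shows "\<exists>\<alpha>>0. \<forall>n::nat.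
           measure (poisson_space n)
             {\<omega> \<in> space (poisson_space n). contains_scaled_copy S \<epsilon> (poisson_sample \<omega>)}
           \<ge> 1 - exp (- \<alpha> * real n)"
proof -
  define d where "d = CARD('n)"
  have d: "1 \<le> d" by (simp add: d_def Suc_le_eq)
  have \<epsilon>: "0 < \<epsilon>" using assms(3) by (simp add: admissible_radius_def)
  \<comment> \<open>A subcube of side \<open>1 / (2 * k)\<close> has inner balls of radius
    \<open>\<epsilon> / (8 * sqrt d) / k\<close>, hence of measure
    \<open>vol / k ^ d\<close>.\<close>
  define vol where "vol = unit_ball_vol (real d) * (\<epsilon> / (8 * sqrt (real d))) ^ d"
  \<comment> \<open>As \<open>k ^ d \<le> 2 ^ d * n\<close>, each ball expects at least
    \<open>vol / 2 ^ d\<close> points; as \<open>n \<le> k ^ d\<close>, each subcube expects at most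
    1, whence the factor \<open>exp (- 1)\<close>. This \<open>q\<close> serves as
    \<open>\<alpha>\<close>.\<close>
  define q where "q = (vol / 2 ^ d) ^ card S * exp (- 1)"
  have vol: "0 < vol" using \<epsilon> d by (simp add: vol_def)
  have q: "0 < q" using vol by (simp add: q_def)
  have "1 - exp (- q * real n) \<le> measure (poisson_space n)
      {\<omega> \<in> space (poisson_space n). contains_scaled_copy S \<epsilon> (poisson_sample \<omega>)}"
    (is "_ \<le> measure _ ?G") for n
  \<comment> \<open>For \<open>n = 0\<close> the lower bound is 0.\<close>
  proof (cases "n = 0")
    case False
    then obtain k where k: "1 \<le> k" "n \<le> k ^ d" "k ^ d \<le> 2 ^ d * n"
      using exists_grid_size[of n d] d by auto
    have kd: "0 < real k ^ d" using k by simp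
    define l where "l = 1 / (2 * real k)"
    have l: "0 < l" using k by (simp add: l_def)
    let ?U = "uniform_measure lborel (cbox 0 (1 :: real ^ 'n))"
    let ?J = "(UNIV :: 'n set) \<rightarrow>\<^sub>E {..<k}"
    let ?B = "\<lambda>v a. to_inner_cube (grid_center k v :: real ^ 'n) l ` ball a \<epsilon>"
    let ?Q = "\<lambda>v. subcube (grid_center k v :: real ^ 'n) l"
    let ?M = "poisson_space n :: (nat \<times> (nat \<Rightarrow> real ^ 'n)) measure"
    let ?E = "\<lambda>v. {\<omega> \<in> space ?M. pattern S (?B v) (?Q v) (fst \<omega>) (snd \<omega>)}"
    have rate: "0 < real n" using False by simp
    have M: "?M = measure_pmf (poisson_pmf (real n)) \<Otimes>\<^sub>M (\<Pi>\<^sub>M i\<in>UNIV. ?U)"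
      using False by (simp add: poisson_space_def)
    interpret P: prob_space "\<Pi>\<^sub>M i\<in>(UNIV :: nat set). ?U"
      by (rule prob_space_PiM) (rule prob_space_uniform_unit_cube)
    interpret PP: pair_prob_space "measure_pmf (poisson_pmf (real n))" "\<Pi>\<^sub>M i\<in>(UNIV :: nat set). ?U" ..
    interpret prob_space ?M unfolding M by unfold_locales
    have B: "?B v a \<in> sets ?U" for v a
      by (simp add: to_inner_cube_image_ball[OF l])
    have Q: "?Q v \<in> sets ?U" for v by (simp add: subcube_def)
    have disj_B: "disjoint_family_on (?B v) S" for v
      using assms(3) inj_to_inner_cube[OF l, of "grid_center k v"]
      by (simp add: admissible_radius_def disjoint_family_on_def flip: image_Int)
    have sub: "(\<Union>a\<in>S. ?B v a) \<subseteq> ?Q v" for v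
      using assms(3) to_inner_cube_in_subcube[OF l] unfolding admissible_radius_def by blast
    have disj_Q: "disjoint_family_on ?Q ?J"
      using disjoint_grid_subcubes[of k] k unfolding l_def by simp
    have in_cube: "?Q v \<subseteq> cbox 0 1" if "v \<in> ?J" for v
      using grid_subcube_in_unit_cube[OF that] k unfolding l_def by simp
    have Q_prob: "measure ?U (?Q v) = (1 / 2) ^ d / real k ^ d" if "v \<in> ?J" for v
      using Q in_cube[OF that]
      by (simp add: measure_uniform_unit_cube measure_subcube[OF l])
         (simp add: l_def d_def power_divide power_mult_distrib)
    have B_prob: "measure ?U (?B v a) = vol / real k ^ d" if "v \<in> ?J" "a \<in> S" for v a
    proof -
      have "?B v a \<subseteq> cbox 0 1" using sub[of v] in_cube[OF that(1)] that(2) by blast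
      then have "measure ?U (?B v a) =
          unit_ball_vol (real d) * (l / (4 * sqrt (real d)) * \<epsilon>) ^ d"
        using l \<epsilon> B[of v a]
        by (simp add: measure_uniform_unit_cube to_inner_cube_image_ball content_ball d_def)
      also have "l / (4 * sqrt (real d)) * \<epsilon> = \<epsilon> / (8 * sqrt (real d)) / real k"
        by (simp add: l_def)
      finally show ?thesis by (simp add: vol_def power_divide power_mult_distrib)
    qed
    have E_prob: "q \<le> prob (?E v)" if v: "v \<in> ?J" for v
    proof -
      have "vol * real (k ^ d) \<le> vol * real (2 ^ d * n)"
        using k(3) vol by (simp only: mult_le_cancel_left_pos of_nat_le_iff)
      then have "vol / 2 ^ d \<le> real n * (vol / real k ^ d)"
        using kd by (simp add: field_simps)
      then have "(vol / 2 ^ d) ^ card S \<le> (real n * (vol / real k ^ d)) ^ card S"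
        using vol by (intro power_mono) auto
      moreover have "real n * ((1 / 2) ^ d / real k ^ d) \<le> 1"
      proof -
        have "real n \<le> real k ^ d"
          using k(2) by (simp only: of_nat_le_iff flip: of_nat_power)
        moreover have "(1 / 2 :: real) ^ d \<le> 1" by (simp add: power_le_one)
        ultimately have "real n * (1 / 2) ^ d \<le> real k ^ d * 1"
          by (intro mult_mono) auto
        then show ?thesis using kd by (simp add: divide_le_eq)
      qed
      ultimately have "q \<le> (real n * (vol / real k ^ d)) ^ card S *
          exp (- real n * ((1 / 2) ^ d / real k ^ d))"
        unfolding q_def using vol by (intro mult_mono) auto
      also have "\<dots> = prob (?E v)"
        using measure_poisson_pattern(2)[OF rate prob_space_uniform_unit_cube assms(1) B Q disj_B sub,
            folded M, of v] v
        by (simp add: B_prob Q_prob)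
      finally show ?thesis .
    qed
    have indep: "indep_events ?E ?J"
      using indep_events_poisson_pattern[OF rate prob_space_uniform_unit_cube assms(1) B Q disj_B
          disj_Q sub] unfolding M .
    have fin: "finite ?J" by (intro finite_PiE) auto
    have "prob (space ?M - (\<Union>v\<in>?J. ?E v)) = (\<Prod>v\<in>?J. 1 - prob (?E v))"
      using prob_compl_UN_indep_events[OF indep fin] .
    \<comment> \<open>Each factor is at most \<open>1 - q\<close>, and
      \<open>1 - q \<le> exp (- q)\<close>; the number of factors is \<open>k ^ d\<close>, which is
      at least \<open>n\<close>.\<close>
    also have "\<dots> \<le> (\<Prod>v\<in>?J. exp (- q))"
    proof (intro prod_mono conjI)
      fix v assume "v \<in> ?J"
      then show "1 - prob (?E v) \<le> exp (- q)"
        using E_prob[of v] exp_ge_add_one_self[of "- q"] by linarith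
    qed simp
    also have "\<dots> = exp (- q * real (k ^ d))"
      by (simp add: card_funcsetE d_def flip: exp_of_nat_mult)
    also have "\<dots> \<le> exp (- q * real n)"
      using k(2) q by (simp del: of_nat_power)
    finally have fail: "prob (space ?M - (\<Union>v\<in>?J. ?E v)) \<le> exp (- q * real n)" .
    have G: "?G \<in> events"
      by (rule sets_poisson_space_contains_scaled_copy) fact+
    have "(\<Union>v\<in>?J. ?E v) \<subseteq> ?G"
      using pattern_imp_scaled_copy_in in_cube l
      unfolding contains_scaled_copy_def poisson_sample_def by blast
    then have "1 - prob ?G \<le> prob (space ?M - (\<Union>v\<in>?J. ?E v))"
      unfolding prob_compl[OF G, symmetric]
      using indep fin by (intro finite_measure_mono sets.compl_sets sets.finite_UN)
        (auto simp: indep_events_def)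
    then show ?thesis using fail by linarith
  qed simp
  then show ?thesis using q by blast
qed

end
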